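(* Let $P$ be a rectangular poset of width $w$ and height $h$, and let $Q$ be any finite poset. Then the maximum size of a semiantichain in $P\times Q$ equals the minimum size of a unichain covering of $P\times Q$, and this number is $w\,d_h(Q)$.
   Context: A weak order is a poset whose ground set is partitioned into levels $L_1,\dots,L_h$ such that $x<y$ iff the level index of $x$ is smaller than that of $y$. A finite poset $P$ is rectangular (of width $w$ and height $h$) if, on the same ground set, there are a poset $L$ that is the disjoint union of $w$ chains each with $h$ elements and a weak order $U$ with $h$ levels each of size $w$ such that $L\subseteq P\subseteq U$ as binary relations. The product $P\times Q$ is ordered componentwise. A unichain is a chain of the form $\{p\}\times C'$ ($C'$ a chain of $Q$) or $C\times\{q\}$ ($C$ a chain of $P$); a unichain covering is a family of unichains whose union is $P\times Q$; a semiantichain is a set $S\subseteq P\times Q$ no two distinct elements of which lie in a common unichain. $d_k(Q)$ is the maximum size of a union of $k$ antichains of $Q$. *)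

theory Defs
  imports Main "HOL-Library.Disjoint_Sets"
begin

text \<open>A poset is a carrier set \<^term>\<open>A\<close> together with a reflexive order relation \<^term>\<open>r\<close> satisfying
  \<^term>\<open>partial_order_on A r\<close>. Since such an \<^term>\<open>r\<close> is reflexive on \<^term>\<open>A\<close> and contained in
  \<^term>\<open>A \<times> A\<close>, its chains (subsets of \<^term>\<open>A\<close>) are exactly the elements of
  \<^term>\<open>Chains r\<close>.\<close>

definition weak_order_levels :: "'a set \<Rightarrow> 'a rel \<Rightarrow> nat \<Rightarrow> (nat \<Rightarrow> 'a set) \<Rightarrow> bool" where
  "weak_order_levels A r h Lv \<longleftrightarrow>
     partial_order_on A r \<and>
     disjoint_family_on Lv {1..h} \<and> (\<Union>i\<in>{1..h}. Lv i) = A \<and>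
     (\<forall>i\<in>{1..h}. \<forall>j\<in>{1..h}. \<forall>x\<in>Lv i. \<forall>y\<in>Lv j. ((x, y) \<in> r \<and> x \<noteq> y) \<longleftrightarrow> i < j)"

definition disjoint_union_of_chains :: "'a set \<Rightarrow> 'a rel \<Rightarrow> nat \<Rightarrow> (nat \<Rightarrow> 'a set) \<Rightarrow> bool" where
  "disjoint_union_of_chains A r w C \<longleftrightarrow>
     partial_order_on A r \<and>
     disjoint_family_on C {1..w} \<and> (\<Union>i\<in>{1..w}. C i) = A \<and>
     (\<forall>i\<in>{1..w}. C i \<in> Chains r) \<and>
     (\<forall>i\<in>{1..w}. \<forall>j\<in>{1..w}. \<forall>x\<in>C i. \<forall>y\<in>C j. i \<noteq> j \<longrightarrow> (x, y) \<notin> r)"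

definition rectangular :: "'a set \<Rightarrow> 'a rel \<Rightarrow> nat \<Rightarrow> nat \<Rightarrow> bool" where
  "rectangular A r w h \<longleftrightarrow>
     finite A \<and> partial_order_on A r \<and>
     (\<exists>L U.
        (\<exists>C. disjoint_union_of_chains A L w C \<and> (\<forall>i\<in>{1..w}. card (C i) = h)) \<and>
        (\<exists>Lv. weak_order_levels A U h Lv \<and> (\<forall>i\<in>{1..h}. card (Lv i) = w)) \<and>
        L \<subseteq> r \<and> r \<subseteq> U)"

definition prod_order :: "'a rel \<Rightarrow> 'b rel \<Rightarrow> ('a \<times> 'b) rel" where
  "prod_order r s = {((p, q), (p', q')). (p, p') \<in> r \<and> (q, q') \<in> s}"

definition unichain :: "'a set \<Rightarrow> 'a rel \<Rightarrow> 'b set \<Rightarrow> 'b rel \<Rightarrow> ('a \<times> 'b) set \<Rightarrow> bool" where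
  "unichain A r B s X \<longleftrightarrow>
     X \<in> Chains (prod_order r s) \<and>
     ((\<exists>p\<in>A. \<exists>C'\<in>Chains s. X = {p} \<times> C') \<or> (\<exists>C\<in>Chains r. \<exists>q\<in>B. X = C \<times> {q}))"

definition unichain_covering ::
  "'a set \<Rightarrow> 'a rel \<Rightarrow> 'b set \<Rightarrow> 'b rel \<Rightarrow> ('a \<times> 'b) set set \<Rightarrow> bool" where
  "unichain_covering A r B s \<F> \<longleftrightarrow> (\<forall>X\<in>\<F>. unichain A r B s X) \<and> \<Union>\<F> = A \<times> B"

definition semiantichain :: "'a set \<Rightarrow> 'a rel \<Rightarrow> 'b set \<Rightarrow> 'b rel \<Rightarrow> ('a \<times> 'b) set \<Rightarrow> bool" where
  "semiantichain A r B s S \<longleftrightarrow>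
     S \<subseteq> A \<times> B \<and>
     (\<forall>x\<in>S. \<forall>y\<in>S. x \<noteq> y \<longrightarrow> \<not> (\<exists>X. unichain A r B s X \<and> x \<in> X \<and> y \<in> X))"

definition antichain :: "'a set \<Rightarrow> 'a rel \<Rightarrow> 'a set \<Rightarrow> bool" where
  "antichain A r X \<longleftrightarrow> X \<subseteq> A \<and> (\<forall>x\<in>X. \<forall>y\<in>X. x \<noteq> y \<longrightarrow> (x, y) \<notin> r)"

definition max_antichain_union :: "nat \<Rightarrow> 'a set \<Rightarrow> 'a rel \<Rightarrow> nat" where
  "max_antichain_union k A r =
     Max {card (\<Union>i<k. F i) | F. \<forall>i<k. antichain A r (F i)}"

definition max_semiantichain_size :: "'a set \<Rightarrow> 'a rel \<Rightarrow> 'b set \<Rightarrow> 'b rel \<Rightarrow> nat" where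
  "max_semiantichain_size A r B s = Max {card S | S. semiantichain A r B s S}"

definition min_unichain_covering_size :: "'a set \<Rightarrow> 'a rel \<Rightarrow> 'b set \<Rightarrow> 'b rel \<Rightarrow> nat" where
  "min_unichain_covering_size A r B s = Min {card \<F> | \<F>. unichain_covering A r B s \<F>}"

text \<open>For finite posets the sets under \<^term>\<open>Max\<close> and \<^term>\<open>Min\<close> are finite and nonempty, and every
  covering is a finite family, so these extrema and cardinalities are the genuine ones.\<close>

lemma antichain_union_sizes:
  assumes "finite A"
  shows "finite {card (\<Union>i<k. F i) | F. \<forall>i<k. antichain A r (F i)}"
    and "{card (\<Union>i<(k::nat). F i) | F. \<forall>i<k. antichain A r (F i)} \<noteq> {}"
proof -
  have "card (\<Union>i<k. F i) \<le> card A" if "\<forall>i<k. antichain A r (F i)" for F :: "nat \<Rightarrow> 'a set"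
  proof (rule card_mono[OF assms])
    show "(\<Union>i<k. F i) \<subseteq> A" using that by (fastforce simp: antichain_def)
  qed
  then have "{card (\<Union>i<k. F i) | F. \<forall>i<k. antichain A r (F i)} \<subseteq> {..card A}"
    by auto
  then show "finite {card (\<Union>i<k. F i) | F. \<forall>i<k. antichain A r (F i)}"
    by (rule finite_subset) simp
  have "card (\<Union>i<k. (\<lambda>_. {}) i) \<in> {card (\<Union>i<k. F i) | F. \<forall>i<k. antichain A r (F i)}"
    by (rule CollectI, rule exI[of _ "\<lambda>_. {}"]) (simp add: antichain_def)
  then show "{card (\<Union>i<k. F i) | F. \<forall>i<k. antichain A r (F i)} \<noteq> {}"
    by (metis empty_iff)
qed

lemma semiantichain_sizes:
  assumes "finite A" "finite B"
  shows "finite {card S | S. semiantichain A r B s S}"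
    and "{card S | S. semiantichain A r B s S} \<noteq> {}"
proof -
  have "{card S | S. semiantichain A r B s S} \<subseteq> card ` Pow (A \<times> B)"
    unfolding semiantichain_def by blast
  then show "finite {card S | S. semiantichain A r B s S}"
    by (rule finite_subset) (use assms in simp)
  have "semiantichain A r B s {}" by (simp add: semiantichain_def)
  then show "{card S | S. semiantichain A r B s S} \<noteq> {}" by auto
qed

lemma unichain_covering_sizes:
  assumes "finite A" "finite B" "partial_order_on A r" "partial_order_on B s"
  shows "unichain_covering A r B s \<F> \<Longrightarrow> finite \<F>"
    and "finite {card \<F> | \<F>. unichain_covering A r B s \<F>}"
    and "{card \<F> | \<F>. unichain_covering A r B s \<F>} \<noteq> {}"
proof -
  have fin: "finite (Pow (A \<times> B))" using assms by simp
  have sub: "\<F> \<subseteq> Pow (A \<times> B)" if "unichain_covering A r B s \<F>" for \<F>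
    using that unfolding unichain_covering_def by blast
  show "unichain_covering A r B s \<F> \<Longrightarrow> finite \<F>" using finite_subset[OF sub fin] .
  have "{card \<F> | \<F>. unichain_covering A r B s \<F>} \<subseteq> card ` Pow (Pow (A \<times> B))"
  proof
    fix n assume "n \<in> {card \<F> | \<F>. unichain_covering A r B s \<F>}"
    then obtain \<G> where "n = card \<G>" "unichain_covering A r B s \<G>" by auto
    then show "n \<in> card ` Pow (Pow (A \<times> B))" using sub[of \<G>] by (intro image_eqI PowI)
  qed
  then show "finite {card \<F> | \<F>. unichain_covering A r B s \<F>}"
    by (rule finite_subset) (use fin in simp)
  have refl: "\<And>p. p \<in> A \<Longrightarrow> (p, p) \<in> r" "\<And>q. q \<in> B \<Longrightarrow> (q, q) \<in> s"
    using partial_order_onD(1)[OF assms(3)] partial_order_onD(1)[OF assms(4)]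
    by (simp_all add: refl_on_def)
  have uni: "unichain A r B s {x}" if "x \<in> A \<times> B" for x
  proof -
    obtain p q where x: "x = (p, q)" and p: "p \<in> A" and q: "q \<in> B" using \<open>x \<in> A \<times> B\<close> by (rule SigmaE)
    have 1: "{q} \<in> Chains s" and 2: "{x} \<in> Chains (prod_order r s)" and 3: "{x} = {p} \<times> {q}"
      using refl(1)[OF p] refl(2)[OF q] by (simp_all add: x Chains_def prod_order_def)
    show ?thesis
      unfolding unichain_def by (intro conjI disjI1 2 bexI[of _ p] bexI[of _ "{q}"] 3 1 p)
  qed
  have "unichain_covering A r B s ((\<lambda>x. {x}) ` (A \<times> B))"
    unfolding unichain_covering_def using uni by (intro conjI ballI) (erule imageE, simp, simp)
  then show "{card \<F> | \<F>. unichain_covering A r B s \<F>} \<noteq> {}" by auto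
qed

end

theory Submission
  imports Defs
begin

text \<open>
  If \<open>F\<close> is a disjoint family of \<open>h\<close> antichains of \<open>Q\<close> of maximum total size, pairing the levels of
  the weak order above \<open>P\<close> with the members of \<open>F\<close> gives a semiantichain of the required size.
  Conversely, Greene--Kleitman duality covers \<open>Q\<close> by a set \<open>S\<close> of points and a set \<open>D\<close> of chains with
  \<open>card S + h * card D \<le> d\<^sub>h(Q)\<close>. The products of the \<open>w\<close> chains below \<open>P\<close> with the points of \<open>S\<close>,
  together with the products of the \<open>w * h\<close> points of \<open>P\<close> with the chains in \<open>D\<close>, form a covering of
  matching size.

  Greene--Kleitman duality is linear programming duality for an assignment problem in which every
  element of \<open>Q\<close> chooses its successor in a chain: the integral potentials of an optimal dual solution
  take at most \<open>h\<close> relevant values, whose level sets are antichains.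
\<close>

subsection \<open>Hall's marriage theorem\<close>

definition hall_condition :: "'i set \<Rightarrow> ('i \<Rightarrow> 'b set) \<Rightarrow> bool" where
  "hall_condition I A \<longleftrightarrow> (\<forall>J\<subseteq>I. card J \<le> card (\<Union>(A ` J)))"

lemma hall_conditionD: "hall_condition I A \<Longrightarrow> J \<subseteq> I \<Longrightarrow> card J \<le> card (\<Union>(A ` J))"
  by (simp add: hall_condition_def)

lemma hall_condition_fun_upd_violation:
  assumes "finite I" and hall: "hall_condition I A" and "\<not> hall_condition I (A(i := B))"
  obtains J where "J \<subseteq> I - {i}" "card (\<Union>(A ` J) \<union> B) \<le> card J"
proof -
  obtain J where J: "J \<subseteq> I" and less: "card (\<Union>((A(i := B)) ` J)) < card J"
    using assms(3) by (auto simp: hall_condition_def not_le)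
  have "i \<in> J"
  proof (rule ccontr)
    assume "i \<notin> J"
    then have "\<Union>((A(i := B)) ` J) = \<Union>(A ` J)" by auto
    then show False using less hall_conditionD[OF hall J] by simp
  qed
  then have "\<Union>((A(i := B)) ` J) = \<Union>(A ` (J - {i})) \<union> B" by (auto split: if_splits)
  moreover have "card J = Suc (card (J - {i}))"
    using \<open>i \<in> J\<close> J \<open>finite I\<close> by (metis card_Suc_Diff1 finite_subset)
  ultimately have "card (\<Union>(A ` (J - {i})) \<union> B) \<le> card (J - {i})" using less by simp
  then show ?thesis using that[of "J - {i}"] J by blast
qed

text \<open>Rado's argument: \<open>J \<mapsto> card (\<Union>(A ` J))\<close> is submodular, so violations on both sides would combine
  into one for \<open>A\<close>.\<close>

lemma hall_condition_remove_element:
  assumes finI: "finite I" and finA: "\<And>j. j \<in> I \<Longrightarrow> finite (A j)"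
    and hall: "hall_condition I A" and "i \<in> I" "x \<noteq> y"
  shows "hall_condition I (A(i := A i - {x})) \<or> hall_condition I (A(i := A i - {y}))"
proof (rule ccontr)
  assume "\<not> ?thesis"
  then obtain J K
    where J: "J \<subseteq> I - {i}" "card (\<Union>(A ` J) \<union> (A i - {x})) \<le> card J"
      and K: "K \<subseteq> I - {i}" "card (\<Union>(A ` K) \<union> (A i - {y})) \<le> card K"
    using hall_condition_fun_upd_violation[OF finI hall] by (metis (no_types, lifting))
  define V W where "V = \<Union>(A ` J) \<union> (A i - {x})" and "W = \<Union>(A ` K) \<union> (A i - {y})"
  have finJK: "finite J" "finite K" using J(1) K(1) finI by (auto intro: finite_subset)
  have finVW: "finite V" "finite W"
    using finJK finA \<open>i \<in> I\<close> J(1) K(1) by (auto simp: V_def W_def)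
  have "Suc (card (J \<union> K)) = card (insert i (J \<union> K))"
    using finJK J(1) K(1) by (subst card_insert_disjoint) auto
  also have "\<dots> \<le> card (\<Union>(A ` insert i (J \<union> K)))"
    using J(1) K(1) \<open>i \<in> I\<close> by (intro hall_conditionD[OF hall]) auto
  also have "\<dots> \<le> card (V \<union> W)"
    using finVW \<open>x \<noteq> y\<close> by (intro card_mono) (auto simp: V_def W_def)
  finally have union: "Suc (card (J \<union> K)) \<le> card (V \<union> W)" .
  have "card (J \<inter> K) \<le> card (\<Union>(A ` (J \<inter> K)))"
    using J(1) by (intro hall_conditionD[OF hall]) auto
  also have "\<dots> \<le> card (V \<inter> W)"
    using finVW by (intro card_mono) (auto simp: V_def W_def)
  finally have "Suc (card J + card K) \<le> card V + card W"
    using union card_Un_Int[OF finJK] card_Un_Int[OF finVW] by linarith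
  then show False using J(2) K(2) by (simp add: V_def W_def)
qed

theorem hall_marriage:
  assumes "finite I" "\<And>i. i \<in> I \<Longrightarrow> finite (A i)" "hall_condition I A"
  shows "\<exists>f. inj_on f I \<and> (\<forall>i\<in>I. f i \<in> A i)"
  using assms
proof (induction "\<Sum>i\<in>I. card (A i)" arbitrary: A rule: less_induct)
  case less
  note finI = less.prems(1) and finA = less.prems(2) and hall = less.prems(3)
  show ?case
  proof (cases "\<exists>i\<in>I. \<exists>x\<in>A i. \<exists>y\<in>A i. x \<noteq> y")
    case True
    then obtain i x where i: "i \<in> I" and x: "x \<in> A i" and hall': "hall_condition I (A(i := A i - {x}))"
      using hall_condition_remove_element[OF finI finA hall] by metis
    have "card (A i - {x}) < card (A i)" using x finA[OF i] by (intro card_Diff1_less)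
    then have "(\<Sum>j\<in>I. card ((A(i := A i - {x})) j)) < (\<Sum>j\<in>I. card (A j))"
      using finI i by (intro sum_strict_mono_ex1) (auto simp: less_imp_le)
    then have "\<exists>f. inj_on f I \<and> (\<forall>j\<in>I. f j \<in> (A(i := A i - {x})) j)"
      by (rule less.hyps) (use finI finA hall' in \<open>auto simp: fun_upd_def\<close>)
    then show ?thesis by (fastforce split: if_splits)
  next
    case False
    have "A i \<noteq> {}" if "i \<in> I" for i using hall_conditionD[OF hall, of "{i}"] that by auto
    then have "\<forall>i\<in>I. \<exists>x. x \<in> A i" by blast
    then obtain f where f: "\<And>i. i \<in> I \<Longrightarrow> f i \<in> A i" by metis
    then have single: "A i = {f i}" if "i \<in> I" for i using False that by blast
    have "inj_on f I"
    proof (rule inj_onI, rule ccontr)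
      fix i j assume "i \<in> I" "j \<in> I" "f i = f j" "i \<noteq> j"
      then show False using hall_conditionD[OF hall, of "{i, j}"] by (simp add: single)
    qed
    then show ?thesis using f by blast
  qed
qed

subsection \<open>Duality for the assignment problem\<close>

definition feasible_potentials ::
  "'x set \<Rightarrow> 'y set \<Rightarrow> ('x \<Rightarrow> 'y \<Rightarrow> bool) \<Rightarrow> ('x \<Rightarrow> 'y \<Rightarrow> 'c::ordered_comm_monoid_add) \<Rightarrow>
    ('x \<Rightarrow> 'c) \<Rightarrow> ('y \<Rightarrow> 'c) \<Rightarrow> bool" where
  "feasible_potentials X Y E c u v \<longleftrightarrow> (\<forall>x\<in>X. \<forall>y\<in>Y. E x y \<longrightarrow> u x + v y \<le> c x y)"

definition optimal_potentials ::
  "'x set \<Rightarrow> 'y set \<Rightarrow> ('x \<Rightarrow> 'y \<Rightarrow> bool) \<Rightarrow> ('x \<Rightarrow> 'y \<Rightarrow> 'c::ordered_comm_monoid_add) \<Rightarrow>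
    ('x \<Rightarrow> 'c) \<Rightarrow> ('y \<Rightarrow> 'c) \<Rightarrow> bool" where
  "optimal_potentials X Y E c u v \<longleftrightarrow>
     feasible_potentials X Y E c u v \<and>
     (\<forall>u' v'. feasible_potentials X Y E c u' v' \<longrightarrow> sum u' X + sum v' Y \<le> sum u X + sum v Y)"

definition tight_neighbours ::
  "'y set \<Rightarrow> ('x \<Rightarrow> 'y \<Rightarrow> bool) \<Rightarrow> ('x \<Rightarrow> 'y \<Rightarrow> 'c::plus) \<Rightarrow> ('x \<Rightarrow> 'c) \<Rightarrow> ('y \<Rightarrow> 'c) \<Rightarrow> 'x \<Rightarrow> 'y set" where
  "tight_neighbours Y E c u v x = {y\<in>Y. E x y \<and> u x + v y = c x y}"

lemma sum_bij_betw_potentials: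
  fixes u :: "'x \<Rightarrow> 'c::comm_monoid_add"
  assumes "bij_betw f X Y"
  shows "(\<Sum>x\<in>X. u x + v (f x)) = sum u X + sum v Y"
  using sum.reindex_bij_betw[OF assms, of v] by (simp add: sum.distrib)

lemma feasible_potentials_le_cost:
  assumes "feasible_potentials X Y E c u v" "bij_betw m X Y" "\<And>x. x \<in> X \<Longrightarrow> E x (m x)"
  shows "sum u X + sum v Y \<le> (\<Sum>x\<in>X. c x (m x))"
proof -
  have "sum u X + sum v Y = (\<Sum>x\<in>X. u x + v (m x))"
    by (rule sum_bij_betw_potentials[OF assms(2), symmetric])
  also have "\<dots> \<le> (\<Sum>x\<in>X. c x (m x))"
    using assms(1,3) bij_betwE[OF assms(2)] by (intro sum_mono) (auto simp: feasible_potentials_def)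
  finally show ?thesis .
qed

lemma optimal_potentials_exist:
  fixes c :: "'x \<Rightarrow> 'y \<Rightarrow> int"
  assumes "finite Y" "bij_betw m X Y" "\<And>x. x \<in> X \<Longrightarrow> E x (m x)"
  obtains u v where "optimal_potentials X Y E c u v"
proof -
  define M where "M = (\<Sum>x\<in>X. c x (m x))"
  define gap where "gap = (\<lambda>(u, v). nat (M - (sum u X + sum v Y)))"
  let ?feas = "\<lambda>(u, v). feasible_potentials X Y E c u v"
  have "?feas (\<lambda>x. Min (c x ` Y), \<lambda>_. 0)" using \<open>finite Y\<close> by (simp add: feasible_potentials_def)
  then obtain u v where uv: "feasible_potentials X Y E c u v"
    and least: "\<And>p. ?feas p \<Longrightarrow> gap (u, v) \<le> gap p"
    using ex_has_least_nat[of ?feas _ gap] by blast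
  have "sum u' X + sum v' Y \<le> sum u X + sum v Y" if "feasible_potentials X Y E c u' v'" for u' v'
    using least[of "(u', v')"] that feasible_potentials_le_cost[OF that assms(2,3)]
    by (auto simp: gap_def M_def)
  then have "optimal_potentials X Y E c u v" using uv by (simp add: optimal_potentials_def)
  then show ?thesis using that by blast
qed

lemma optimal_potentials_hall_condition:
  fixes c :: "'x \<Rightarrow> 'y \<Rightarrow> int"
  assumes fin: "finite X" "finite Y" and opt: "optimal_potentials X Y E c u v"
  shows "hall_condition X (tight_neighbours Y E c u v)" (is "hall_condition X ?T")
  unfolding hall_condition_def
proof (intro allI impI)
  fix J assume J: "J \<subseteq> X"
  define N where "N = \<Union>(?T ` J)"
  \<comment> \<open>Raising the potential on \<open>J\<close> by one and lowering it on the tight neighbours of \<open>J\<close> by one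
    preserves feasibility, because the costs are integral.\<close>
  define u' where "u' x = u x + of_bool (x \<in> J)" for x
  define v' where "v' y = v y - of_bool (y \<in> N)" for y
  have "feasible_potentials X Y E c u' v'"
    unfolding feasible_potentials_def
  proof (intro ballI impI)
    fix x y assume xy: "x \<in> X" "y \<in> Y" "E x y"
    then have "u x + v y \<le> c x y"
      using opt by (simp add: optimal_potentials_def feasible_potentials_def)
    moreover have "u x + v y \<noteq> c x y" if "x \<in> J" "y \<notin> N"
      using that xy by (auto simp: N_def tight_neighbours_def)
    ultimately show "u' x + v' y \<le> c x y"
      by (cases "x \<in> J"; cases "y \<in> N") (auto simp: u'_def v'_def)
  qed
  then have "sum u' X + sum v' Y \<le> sum u X + sum v Y" using opt by (simp add: optimal_potentials_def)
  moreover have "sum u' X = sum u X + int (card J)"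
    using fin J by (simp add: u'_def sum.distrib Int_absorb1)
  moreover have "N \<subseteq> Y" by (auto simp: N_def tight_neighbours_def)
  then have "sum v' Y = sum v Y - int (card N)"
    using fin by (simp add: v'_def sum_subtractf Int_absorb1)
  ultimately show "card J \<le> card (\<Union>(?T ` J))" by (simp add: N_def)
qed

theorem egervary:
  fixes c :: "'x \<Rightarrow> 'y \<Rightarrow> int"
  assumes fin: "finite X" "finite Y" and matching: "bij_betw m X Y" "\<And>x. x \<in> X \<Longrightarrow> E x (m x)"
  obtains u v f where "feasible_potentials X Y E c u v"
    "bij_betw f X Y" "\<And>x. x \<in> X \<Longrightarrow> E x (f x)" "(\<Sum>x\<in>X. c x (f x)) = sum u X + sum v Y"
proof -
  obtain u v where opt: "optimal_potentials X Y E c u v"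
    using optimal_potentials_exist[where X = X and E = E, OF fin(2) matching] by blast
  then have feas: "feasible_potentials X Y E c u v" by (simp add: optimal_potentials_def)
  have "finite (tight_neighbours Y E c u v x)" for x using fin(2) by (simp add: tight_neighbours_def)
  then obtain f where inj: "inj_on f X" and "\<forall>x\<in>X. f x \<in> tight_neighbours Y E c u v x"
    using hall_marriage[OF fin(1) _ optimal_potentials_hall_condition[OF fin opt]] by blast
  then have tight: "f x \<in> Y \<and> E x (f x) \<and> u x + v (f x) = c x (f x)" if "x \<in> X" for x
    using that by (simp add: tight_neighbours_def)
  have "f ` X = Y"
    using tight inj fin(2) bij_betw_same_card[OF matching(1)] by (intro card_subset_eq) (auto simp: card_image)
  then have bij: "bij_betw f X Y" using inj by (simp add: bij_betw_def)
  have "(\<Sum>x\<in>X. c x (f x)) = (\<Sum>x\<in>X. u x + v (f x))" using tight by (intro sum.cong) auto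
  then show ?thesis using that[OF feas bij] tight sum_bij_betw_potentials[OF bij, of u v] by simp
qed

subsection \<open>Unions of antichains\<close>

lemma card_le_max_antichain_union:
  assumes "finite A" "\<And>i. i < k \<Longrightarrow> antichain A r (F i)"
  shows "card (\<Union>i<k. F i) \<le> max_antichain_union k A r"
  unfolding max_antichain_union_def
  by (rule Max_ge[OF antichain_union_sizes(1)[OF assms(1)]]) (use assms(2) in blast)

lemma max_antichain_union_attained:
  assumes "finite A"
  obtains F where "\<And>i. i < k \<Longrightarrow> antichain A r (F i)" "disjoint_family F"
    "card (\<Union>i<k. F i) = max_antichain_union k A r"
proof -
  obtain F where F: "\<forall>i<k. antichain A r (F i)"
    "card (\<Union>i<k. F i) = max_antichain_union k A r"
    using Max_in[OF antichain_union_sizes[OF assms, of k r]]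
    unfolding max_antichain_union_def by auto
  show ?thesis
  proof (rule that[of "disjointed F"])
    show "antichain A r (disjointed F i)" if "i < k" for i
      using F(1) that disjointed_subset[of F i] unfolding antichain_def by blast
    show "card (\<Union>i<k. disjointed F i) = max_antichain_union k A r"
      using F(2) finite_UN_disjointed_eq[of F k] by (simp add: lessThan_atLeast0)
  qed (rule disjoint_family_disjointed)
qed

lemma sum_diff_le_max_antichain_union:
  fixes a b :: "'b \<Rightarrow> int"
  assumes "finite Q" "refl_on Q s"
    and a_nonneg: "\<And>x. x \<in> Q \<Longrightarrow> 0 \<le> a x" and b_le: "\<And>x. x \<in> Q \<Longrightarrow> b x \<le> int k"
    and b_le_a: "\<And>x y. x \<in> Q \<Longrightarrow> y \<in> Q \<Longrightarrow> (x, y) \<in> s \<Longrightarrow> b y \<le> a x + of_bool (x = y)"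
  shows "(\<Sum>x\<in>Q. b x - a x) \<le> int (max_antichain_union k Q s)"
proof -
  define F where "F i = {x\<in>Q. a x = int i \<and> b x = int i + 1}" for i
  have "antichain Q s (F i)" for i
    unfolding antichain_def
  proof (intro conjI ballI impI notI)
    fix x y assume "x \<in> F i" "y \<in> F i" "x \<noteq> y" "(x, y) \<in> s"
    then show False using b_le_a[of x y] by (simp add: F_def)
  qed (auto simp: F_def)
  have "(\<Sum>x\<in>Q. b x - a x) \<le> (\<Sum>x\<in>Q. of_bool (b x = a x + 1))"
  proof (rule sum_mono)
    fix x assume "x \<in> Q"
    then have "b x \<le> a x + 1" using b_le_a[of x x] refl_onD[OF assms(2)] by simp
    then show "b x - a x \<le> of_bool (b x = a x + 1)" by simp
  qed
  also have "\<dots> = int (card {x\<in>Q. b x = a x + 1})"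
    using \<open>finite Q\<close> by (simp add: Int_def)
  also have "card {x\<in>Q. b x = a x + 1} \<le> card (\<Union>i<k. F i)"
  proof (rule card_mono)
    show "{x\<in>Q. b x = a x + 1} \<subseteq> (\<Union>i<k. F i)"
    proof
      fix x assume "x \<in> {x\<in>Q. b x = a x + 1}"
      then show "x \<in> (\<Union>i<k. F i)"
        using a_nonneg[of x] b_le[of x] by (intro UN_I[of "nat (a x)"]) (auto simp: F_def)
    qed
    show "finite (\<Union>i<k. F i)" using \<open>finite Q\<close> by (simp add: F_def)
  qed
  also have "\<dots> \<le> max_antichain_union k Q s"
    using \<open>finite Q\<close> \<open>\<And>i. antichain Q s (F i)\<close> by (rule card_le_max_antichain_union)
  finally show ?thesis by simp
qed

subsection \<open>Greene--Kleitman duality\<close>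

text \<open>
  In an assignment on two copies of \<open>Q <+> Q\<close>, linking \<open>Inl x\<close> to \<open>Inl y\<close> makes \<open>y\<close> the successor of
  \<open>x\<close> in a chain, or leaves \<open>x\<close> to be covered as a single point if \<open>x = y\<close>. The elements \<open>Inr i\<close>
  are dummies: a link from a dummy starts a chain, a link to a dummy ends one.
\<close>

fun link_allowed :: "'b rel \<Rightarrow> 'b + 'b \<Rightarrow> 'b + 'b \<Rightarrow> bool" where
  "link_allowed s (Inl x) (Inl y) \<longleftrightarrow> (x, y) \<in> s"
| "link_allowed s _ _ \<longleftrightarrow> True"

fun link_cost :: "nat \<Rightarrow> 'b + 'b \<Rightarrow> 'b + 'b \<Rightarrow> int" where
  "link_cost k (Inl x) (Inl y) = of_bool (x = y)"
| "link_cost k (Inr _) (Inl _) = int k"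
| "link_cost k _ (Inr _) = 0"

lemma link_potentials_le_max_antichain_union:
  assumes fin: "finite Q" and refl: "refl_on Q s"
    and feas: "feasible_potentials (Q <+> Q) (Q <+> Q) (link_allowed s) (link_cost k) u v"
  shows "sum u (Q <+> Q) + sum v (Q <+> Q) \<le> int (max_antichain_union k Q s)"
proof (cases "Q = {}")
  case False
  define \<sigma> where "\<sigma> = Max ((u \<circ> Inr) ` Q)"
  define \<tau> where "\<tau> = Max ((v \<circ> Inr) ` Q)"
  have "\<sigma> \<in> (u \<circ> Inr) ` Q" "\<tau> \<in> (v \<circ> Inr) ` Q"
    unfolding \<sigma>_def \<tau>_def using fin False by (intro Max_in; simp)+
  then obtain i j where i: "i \<in> Q" "u (Inr i) = \<sigma>" and j: "j \<in> Q" "v (Inr j) = \<tau>" by auto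
  have feasD: "u z + v t \<le> link_cost k z t" if "z \<in> Q <+> Q" "t \<in> Q <+> Q" "link_allowed s z t" for z t
    using feas that by (simp add: feasible_potentials_def)
  \<comment> \<open>Shifting the potentials lets all dummies have potential 0.\<close>
  define a where "a x = - u (Inl x) - \<tau>" for x
  define b where "b x = v (Inl x) + \<sigma>" for x
  have "sum u (Q <+> Q) + sum v (Q <+> Q) = (\<Sum>x\<in>Q. u (Inl x) + u (Inr x) + v (Inl x) + v (Inr x))"
    unfolding sum.Plus[OF fin fin] by (simp add: sum.distrib)
  also have "\<dots> \<le> (\<Sum>x\<in>Q. b x - a x)"
  proof (rule sum_mono)
    fix x assume "x \<in> Q"
    then have "u (Inr x) \<le> \<sigma>" "v (Inr x) \<le> \<tau>" using fin by (auto simp: \<sigma>_def \<tau>_def)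
    then show "u (Inl x) + u (Inr x) + v (Inl x) + v (Inr x) \<le> b x - a x" by (simp add: a_def b_def)
  qed
  also have "\<dots> \<le> int (max_antichain_union k Q s)"
  proof (rule sum_diff_le_max_antichain_union[OF fin refl])
    show "0 \<le> a x" if "x \<in> Q" for x
      using feasD[of "Inl x" "Inr j"] that j by (simp add: InlI InrI a_def)
    show "b x \<le> int k" if "x \<in> Q" for x
      using feasD[of "Inr i" "Inl x"] that i by (simp add: InlI InrI b_def)
    show "b y \<le> a x + of_bool (x = y)" if "x \<in> Q" "y \<in> Q" "(x, y) \<in> s" for x y
      using feasD[of "Inl x" "Inl y"] feasD[of "Inr i" "Inr j"] that i j
      by (simp add: InlI InrI a_def b_def)
  qed
  finally show ?thesis .
qed (simp add: Plus_def)

definition link_loops :: "'b set \<Rightarrow> ('b + 'b \<Rightarrow> 'b + 'b) \<Rightarrow> 'b set" where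
  "link_loops Q f = {x\<in>Q. f (Inl x) = Inl x}"

definition link_starts :: "'b set \<Rightarrow> ('b + 'b \<Rightarrow> 'b + 'b) \<Rightarrow> 'b set" where
  "link_starts Q f = {y. \<exists>i\<in>Q. f (Inr i) = Inl y}"

definition link_successor :: "'b set \<Rightarrow> ('b + 'b \<Rightarrow> 'b + 'b) \<Rightarrow> 'b rel" where
  "link_successor Q f = {(x, y). x \<in> Q \<and> f (Inl x) = Inl y \<and> x \<noteq> y}"

lemma single_valued_link_successor: "single_valued (link_successor Q f)"
  by (auto simp: single_valued_def link_successor_def)

lemma link_successor_subset:
  assumes "\<And>z. z \<in> Q <+> Q \<Longrightarrow> link_allowed s z (f z)"
  shows "link_successor Q f \<subseteq> s - Id"
proof (clarsimp simp: link_successor_def)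
  fix x y assume "x \<in> Q" "f (Inl x) = Inl y"
  then show "(x, y) \<in> s" using assms[of "Inl x"] by (simp add: InlI)
qed

lemma link_starts_subset:
  assumes "bij_betw f (Q <+> Q) (Q <+> Q)"
  shows "link_starts Q f \<subseteq> Q"
  using bij_betwE[OF assms] by (force simp: link_starts_def)

lemma sum_link_cost:
  assumes fin: "finite Q" and inj: "inj_on f (Q <+> Q)"
  shows "(\<Sum>z\<in>Q <+> Q. link_cost k z (f z)) = int (card (link_loops Q f) + k * card (link_starts Q f))"
proof -
  have "(\<Sum>x\<in>Q. link_cost k (Inl x) (f (Inl x))) = (\<Sum>x\<in>Q. of_bool (f (Inl x) = Inl x))"
  proof (rule sum.cong)
    show "link_cost k (Inl x) (f (Inl x)) = of_bool (f (Inl x) = Inl x)" for x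
      by (cases "f (Inl x)") auto
  qed simp
  also have "\<dots> = int (card (link_loops Q f))"
    using fin by (simp add: link_loops_def Int_def)
  finally have loops: "(\<Sum>x\<in>Q. link_cost k (Inl x) (f (Inl x))) = int (card (link_loops Q f))" .
  let ?I = "{i\<in>Q. isl (f (Inr i))}"
  have "(\<Sum>i\<in>Q. link_cost k (Inr i) (f (Inr i))) = (\<Sum>i\<in>Q. if isl (f (Inr i)) then int k else 0)"
  proof (rule sum.cong)
    show "link_cost k (Inr i) (f (Inr i)) = (if isl (f (Inr i)) then int k else 0)" for i
      by (cases "f (Inr i)") auto
  qed simp
  also have "\<dots> = int (k * card ?I)"
    using fin by (simp add: sum.If_cases Int_def)
  also have "card ?I = card (link_starts Q f)"
  proof (rule bij_betw_same_card[of "\<lambda>i. projl (f (Inr i))"], rule bij_betw_imageI)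
    show "inj_on (\<lambda>i. projl (f (Inr i))) ?I"
    proof (rule inj_onI)
      fix i j assume ij: "i \<in> ?I" "j \<in> ?I" "projl (f (Inr i)) = projl (f (Inr j))"
      then have "f (Inr i) = f (Inr j)" by (auto simp: isl_def)
      then show "i = j" using inj_onD[OF inj, of "Inr i" "Inr j"] ij by (simp add: InrI)
    qed
    show "(\<lambda>i. projl (f (Inr i))) ` ?I = link_starts Q f"
      by (force simp: link_starts_def isl_def)
  qed
  finally show ?thesis using loops unfolding sum.Plus[OF fin fin] by simp
qed

lemma subset_rtrancl_Image:
  assumes "wf G" and "\<And>x. x \<in> X \<Longrightarrow> x \<in> T \<or> (\<exists>w\<in>X. (w, x) \<in> G)"
  shows "X \<subseteq> G\<^sup>* `` T"
proof
  fix x assume "x \<in> X"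
  with assms(1) show "x \<in> G\<^sup>* `` T"
  proof (induction x rule: wf_induct_rule)
    case (less x)
    consider "x \<in> T" | w where "w \<in> X" "(w, x) \<in> G" using assms(2) less.prems by blast
    then show ?case using less.IH by cases (auto intro: rtrancl_into_rtrancl)
  qed
qed

lemma link_successor_covers:
  assumes fin: "finite Q" and po: "partial_order_on Q s" and bij: "bij_betw f (Q <+> Q) (Q <+> Q)"
    and allowed: "\<And>z. z \<in> Q <+> Q \<Longrightarrow> link_allowed s z (f z)"
  shows "Q - link_loops Q f \<subseteq> (link_successor Q f)\<^sup>* `` link_starts Q f"
proof (rule subset_rtrancl_Image)
  have "finite s" using partial_order_onD(4)[OF po] fin by (meson finite_SigmaI finite_subset)
  then have "wf (s - Id)" using po by (rule partial_order_on_well_order_on)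
  then show "wf (link_successor Q f)" using link_successor_subset[OF allowed] by (rule wf_subset)
  fix x assume x: "x \<in> Q - link_loops Q f"
  then obtain z where z: "z \<in> Q <+> Q" "f z = Inl x"
    using bij_betw_imp_surj_on[OF bij] by (metis DiffD1 InlI imageE)
  show "x \<in> link_starts Q f \<or> (\<exists>w\<in>Q - link_loops Q f. (w, x) \<in> link_successor Q f)"
  proof (cases z)
    case (Inl w)
    then have "w \<in> Q - link_loops Q f" "(w, x) \<in> link_successor Q f"
      using x z by (auto simp: link_loops_def link_successor_def)
    then show ?thesis by blast
  next
    case (Inr i)
    then show ?thesis using z by (auto simp: link_starts_def)
  qed
qed

lemma single_valued_rtrancl_Image_in_Chains:
  assumes sv: "single_valued G" and "G \<subseteq> s" and "preorder_on Q s" and "y \<in> Q"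
  shows "G\<^sup>* `` {y} \<in> Chains s"
proof -
  have s: "s \<subseteq> Q \<times> Q" "refl_on Q s" "trans s" using assms(3) by (auto simp: preorder_on_def)
  have below: "(p, q) \<in> s" if "(p, q) \<in> G\<^sup>*" "p \<in> Q" for p q
    using rtranclD[OF that(1)] trancl_mono[OF _ \<open>G \<subseteq> s\<close>] trancl_id[OF s(3)] refl_onD[OF s(2) that(2)]
    by blast
  show ?thesis
    unfolding Chains_def
  proof (intro CollectI ballI)
    fix p q assume pq: "p \<in> G\<^sup>* `` {y}" "q \<in> G\<^sup>* `` {y}"
    then have "p \<in> Q" "q \<in> Q" using below \<open>y \<in> Q\<close> s(1) by blast+
    moreover have "(p, q) \<in> G\<^sup>* \<or> (q, p) \<in> G\<^sup>*" using single_valued_confluent[OF sv] pq by blast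
    ultimately show "(p, q) \<in> s \<or> (q, p) \<in> s" using below by blast
  qed
qed

lemma bij_link_chain_cover:
  assumes fin: "finite Q" and po: "partial_order_on Q s" and bij: "bij_betw f (Q <+> Q) (Q <+> Q)"
    and allowed: "\<And>z. z \<in> Q <+> Q \<Longrightarrow> link_allowed s z (f z)"
  obtains S D where "finite D" "D \<subseteq> Chains s" "Q = S \<union> \<Union>D"
    "int (card S + k * card D) \<le> (\<Sum>z\<in>Q <+> Q. link_cost k z (f z))"
proof -
  let ?G = "link_successor Q f" and ?S = "link_loops Q f" and ?T = "link_starts Q f"
  define D where "D = (\<lambda>y. ?G\<^sup>* `` {y}) ` ?T"
  have starts: "?T \<subseteq> Q" "finite ?T" using link_starts_subset[OF bij] fin finite_subset by auto
  have preorder: "preorder_on Q s" using po by (simp add: partial_order_on_def)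
  have successor: "?G \<subseteq> s" using link_successor_subset[OF allowed] by blast
  have chains: "D \<subseteq> Chains s"
    using single_valued_rtrancl_Image_in_Chains[OF single_valued_link_successor successor preorder] starts(1)
    by (auto simp: D_def)
  have "Q - ?S \<subseteq> \<Union>D" using link_successor_covers[OF fin po bij allowed] by (auto simp: D_def)
  moreover have "\<Union>D \<subseteq> Q"
    using chains partial_order_onD(4)[OF po] by (force simp: Chains_def)
  moreover have "?S \<subseteq> Q" by (auto simp: link_loops_def)
  ultimately have "Q = ?S \<union> \<Union>D" by blast
  moreover have "card D \<le> card ?T" unfolding D_def using starts(2) by (rule card_image_le)
  then have "card ?S + k * card D \<le> card ?S + k * card ?T" by simp
  then have "int (card ?S + k * card D) \<le> (\<Sum>z\<in>Q <+> Q. link_cost k z (f z))"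
    unfolding sum_link_cost[OF fin bij_betw_imp_inj_on[OF bij]] by (simp only: of_nat_le_iff)
  moreover have "finite D" using starts(2) by (simp add: D_def)
  ultimately show ?thesis using that chains by blast
qed

theorem greene_kleitman_cover:
  assumes fin: "finite Q" and po: "partial_order_on Q s"
  obtains S D where "finite D" "D \<subseteq> Chains s" "Q = S \<union> \<Union>D"
    "card S + k * card D \<le> max_antichain_union k Q s"
proof -
  have refl: "refl_on Q s" using partial_order_onD(1)[OF po] .
  have finQQ: "finite (Q <+> Q)" using fin by simp
  have "link_allowed s z (id z)" if "z \<in> Q <+> Q" for z
    using that refl_onD[OF refl] by auto
  then obtain u v f where
    feas: "feasible_potentials (Q <+> Q) (Q <+> Q) (link_allowed s) (link_cost k) u v"
    and bij: "bij_betw f (Q <+> Q) (Q <+> Q)"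
    and allowed: "\<And>z. z \<in> Q <+> Q \<Longrightarrow> link_allowed s z (f z)"
    and cost: "(\<Sum>z\<in>Q <+> Q. link_cost k z (f z)) = sum u (Q <+> Q) + sum v (Q <+> Q)"
    using egervary[OF finQQ finQQ bij_betw_id, of "link_allowed s" "link_cost k"] by blast
  obtain S D where "finite D" "D \<subseteq> Chains s" "Q = S \<union> \<Union>D"
    "int (card S + k * card D) \<le> (\<Sum>z\<in>Q <+> Q. link_cost k z (f z))"
    by (rule bij_link_chain_cover[OF fin po bij allowed])
  then show ?thesis
    using that[of D S] cost link_potentials_le_max_antichain_union[OF fin refl feas] by linarith
qed

subsection \<open>Semiantichains and unichain coverings\<close>

lemma unichain_Times_singleton:
  assumes "C \<in> Chains r" "q \<in> B" "refl_on B s"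
  shows "unichain A r B s (C \<times> {q})"
proof -
  have "C \<times> {q} \<in> Chains (prod_order r s)"
    using assms(1) refl_onD[OF assms(3,2)] by (auto simp: Chains_def prod_order_def)
  then show ?thesis using assms(1,2) unfolding unichain_def by blast
qed

lemma unichain_singleton_Times:
  assumes "p \<in> A" "C \<in> Chains s" "refl_on A r"
  shows "unichain A r B s ({p} \<times> C)"
proof -
  have "{p} \<times> C \<in> Chains (prod_order r s)"
    using assms(2) refl_onD[OF assms(3,1)] by (auto simp: Chains_def prod_order_def)
  then show ?thesis using assms(1,2) unfolding unichain_def by blast
qed

lemma unichain_cases:
  assumes "unichain A r B s X" "(p, q) \<in> X" "(p', q') \<in> X"
  obtains (fst_eq) "p = p'" "(q, q') \<in> s \<or> (q', q) \<in> s" | (snd_eq) "q = q'" "(p, p') \<in> r \<or> (p', p) \<in> r"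
  using assms by (auto simp: unichain_def Chains_def)

lemma semiantichain_UN_Times:
  assumes L: "\<And>i. i \<in> I \<Longrightarrow> antichain A r (L i)" "disjoint_family_on L I"
    and F: "\<And>i. i \<in> I \<Longrightarrow> antichain B s (F i)" "disjoint_family_on F I"
  shows "semiantichain A r B s (\<Union>i\<in>I. L i \<times> F i)" (is "semiantichain A r B s ?S")
  unfolding semiantichain_def
proof (intro conjI ballI impI notI)
  show "?S \<subseteq> A \<times> B" using L(1) F(1) by (fastforce simp: antichain_def)
  fix x y assume "x \<in> ?S" "y \<in> ?S" and neq: "x \<noteq> y"
    and "\<exists>X. unichain A r B s X \<and> x \<in> X \<and> y \<in> X"
  then obtain X i p q j p' q' where X: "unichain A r B s X" "x \<in> X" "y \<in> X"
    and x: "i \<in> I" "p \<in> L i" "q \<in> F i" "x = (p, q)"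
    and y: "j \<in> I" "p' \<in> L j" "q' \<in> F j" "y = (p', q')" by blast
  from X show False unfolding x(4) y(4)
  proof (cases rule: unichain_cases)
    case fst_eq
    then have "i = j" using L(2) x y by (auto simp: disjoint_family_on_def)
    then show False using fst_eq F(1)[of i] x y neq by (auto simp: antichain_def)
  next
    case snd_eq
    then have "i = j" using F(2) x y by (auto simp: disjoint_family_on_def)
    then show False using snd_eq L(1)[of i] x y neq by (auto simp: antichain_def)
  qed
qed

lemma card_UN_Times:
  assumes fin: "finite I" "\<And>i. i \<in> I \<Longrightarrow> finite (L i)" "\<And>i. i \<in> I \<Longrightarrow> finite (F i)"
    and card_L: "\<And>i. i \<in> I \<Longrightarrow> card (L i) = w" and disj: "disjoint_family_on F I"
  shows "card (\<Union>i\<in>I. L i \<times> F i) = w * card (\<Union>i\<in>I. F i)"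
proof -
  have "disjoint_family_on (\<lambda>i. L i \<times> F i) I" using disj by (fastforce simp: disjoint_family_on_def)
  then have "card (\<Union>i\<in>I. L i \<times> F i) = (\<Sum>i\<in>I. card (L i \<times> F i))"
    using fin by (intro card_UN_disjoint') auto
  also have "\<dots> = w * (\<Sum>i\<in>I. card (F i))"
    using card_L by (simp add: card_cartesian_product sum_distrib_left)
  also have "(\<Sum>i\<in>I. card (F i)) = card (\<Union>i\<in>I. F i)"
    using fin disj by (intro card_UN_disjoint'[symmetric]) auto
  finally show ?thesis .
qed

lemma unichain_covering_of_chain_covers:
  assumes "refl_on A r" "refl_on B s" and finA: "finite A" and finB: "finite B"
    and C: "finite \<C>" "\<C> \<subseteq> Chains r" "A = \<Union>\<C>"
    and D: "finite \<D>" "\<D> \<subseteq> Chains s" "B = S \<union> \<Union>\<D>"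
  obtains \<F> where "unichain_covering A r B s \<F>" "card \<F> \<le> card \<C> * card S + card A * card \<D>"
proof -
  define \<F>\<^sub>S where "\<F>\<^sub>S = (\<lambda>(C, q). C \<times> {q}) ` (\<C> \<times> S)"
  define \<F>\<^sub>D where "\<F>\<^sub>D = (\<lambda>(p, X). {p} \<times> X) ` (A \<times> \<D>)"
  have "S \<subseteq> B" using D(3) by blast
  then have "unichain A r B s X" if "X \<in> \<F>\<^sub>S" for X
    using that C(2) by (auto simp: \<F>\<^sub>S_def intro!: unichain_Times_singleton assms(2))
  moreover have "unichain A r B s X" if "X \<in> \<F>\<^sub>D" for X
    using that D(2) by (auto simp: \<F>\<^sub>D_def intro!: unichain_singleton_Times assms(1))
  moreover have "\<Union>(\<F>\<^sub>S \<union> \<F>\<^sub>D) = A \<times> B"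
  proof -
    have "\<Union>\<F>\<^sub>S = A \<times> S" using C(3) by (auto simp: \<F>\<^sub>S_def)
    moreover have "\<Union>\<F>\<^sub>D = A \<times> \<Union>\<D>" by (auto simp: \<F>\<^sub>D_def)
    ultimately show ?thesis using D(3) by (simp add: Union_Un_distrib Sigma_Un_distrib2)
  qed
  ultimately have "unichain_covering A r B s (\<F>\<^sub>S \<union> \<F>\<^sub>D)" by (auto simp: unichain_covering_def)
  moreover have "card (\<F>\<^sub>S \<union> \<F>\<^sub>D) \<le> card \<C> * card S + card A * card \<D>"
  proof -
    have "finite S" using finB D(3) by simp
    have "card (\<F>\<^sub>S \<union> \<F>\<^sub>D) \<le> card \<F>\<^sub>S + card \<F>\<^sub>D" by (rule card_Un_le)
    also have "\<dots> \<le> card (\<C> \<times> S) + card (A \<times> \<D>)"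
      unfolding \<F>\<^sub>S_def \<F>\<^sub>D_def using \<open>finite S\<close> C(1) finA D(1) by (intro add_mono card_image_le) auto
    finally show ?thesis by (simp add: card_cartesian_product)
  qed
  ultimately show ?thesis using that by blast
qed

lemma semiantichain_card_le_covering:
  assumes S: "semiantichain A r B s S" and F: "unichain_covering A r B s \<F>" and "finite \<F>"
  shows "card S \<le> card \<F>"
proof -
  have "S \<subseteq> \<Union>\<F>" using S F unfolding semiantichain_def unichain_covering_def by blast
  then have "\<forall>x\<in>S. \<exists>X\<in>\<F>. x \<in> X" by blast
  then obtain g where g: "\<And>x. x \<in> S \<Longrightarrow> g x \<in> \<F> \<and> x \<in> g x" by metis
  have "inj_on g S"
  proof (rule inj_onI, rule ccontr)
    fix x y assume xy: "x \<in> S" "y \<in> S" "g x = g y" "x \<noteq> y"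
    then have "unichain A r B s (g x)" "x \<in> g x" "y \<in> g x"
      using g[of x] g[of y] F unfolding unichain_covering_def by simp_all
    then show False using S xy unfolding semiantichain_def by blast
  qed
  then show ?thesis using g \<open>finite \<F>\<close> by (intro card_inj_on_le[of g]) auto
qed

lemma semiantichain_unichain_covering_extremal:
  assumes finA: "finite A" and poA: "partial_order_on A r" and finB: "finite B" and poB: "partial_order_on B s"
    and S: "semiantichain A r B s S" and F: "unichain_covering A r B s \<F>" and card_le: "card \<F> \<le> card S"
  shows "max_semiantichain_size A r B s = card S" "min_unichain_covering_size A r B s = card S"
proof -
  note weak_duality = semiantichain_card_le_covering[OF _ _ unichain_covering_sizes(1)[OF finA finB poA poB]]
  show "max_semiantichain_size A r B s = card S"
    unfolding max_semiantichain_size_def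
  proof (rule Max_eqI[OF semiantichain_sizes(1)[OF finA finB]])
    show "n \<le> card S" if "n \<in> {card S |S. semiantichain A r B s S}" for n
      using that weak_duality[OF _ F F] card_le by fastforce
  qed (use S in blast)
  have "card \<F> = card S" using weak_duality[OF S F F] card_le by simp
  show "min_unichain_covering_size A r B s = card S"
    unfolding min_unichain_covering_size_def
  proof (rule Min_eqI[OF unichain_covering_sizes(2)[OF finA finB poA poB]])
    show "card S \<le> n" if "n \<in> {card \<F> |\<F>. unichain_covering A r B s \<F>}" for n
      using that weak_duality[OF S] by blast
    show "card S \<in> {card \<F> |\<F>. unichain_covering A r B s \<F>}"
      using F \<open>card \<F> = card S\<close> by force
  qed
qed

subsection \<open>Rectangular posets\<close>

lemma rectangular_antichain_levels:
  assumes "rectangular P r w h"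
  obtains L where "\<And>i. i < h \<Longrightarrow> antichain P r (L i)" "disjoint_family_on L {..<h}"
    "\<And>i. i < h \<Longrightarrow> card (L i) = w"
proof -
  obtain U Lv where Lv: "weak_order_levels P U h Lv" "\<forall>i\<in>{1..h}. card (Lv i) = w" and "r \<subseteq> U"
    using assms unfolding rectangular_def by blast
  have "antichain P r (Lv i)" if "i \<in> {1..h}" for i
    using Lv(1) \<open>r \<subseteq> U\<close> that unfolding weak_order_levels_def antichain_def by blast
  moreover have "disjoint_family_on (\<lambda>i. Lv (Suc i)) {..<h}"
    using Lv(1) by (auto simp: weak_order_levels_def disjoint_family_on_def)
  ultimately show ?thesis using that[of "\<lambda>i. Lv (Suc i)"] Lv(2) by simp
qed

lemma rectangular_chain_cover:
  assumes "rectangular P r w h"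
  obtains \<C> where "finite \<C>" "\<C> \<subseteq> Chains r" "P = \<Union>\<C>" "card \<C> \<le> w" "card P = w * h"
proof -
  obtain L C where C: "disjoint_union_of_chains P L w C" "\<forall>i\<in>{1..w}. card (C i) = h"
    and "L \<subseteq> r" and "finite P"
    using assms unfolding rectangular_def by blast
  have UC: "P = (\<Union>i\<in>{1..w}. C i)" and disj: "disjoint_family_on C {1..w}"
    and chains: "\<forall>i\<in>{1..w}. C i \<in> Chains L"
    using C(1) by (auto simp: disjoint_union_of_chains_def)
  have "C ` {1..w} \<subseteq> Chains r" using chains \<open>L \<subseteq> r\<close> unfolding Chains_def by blast
  moreover have "card (C ` {1..w}) \<le> w" using card_image_le[of "{1..w}" C] by simp
  moreover have "card P = (\<Sum>i\<in>{1..w}. card (C i))"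
    unfolding UC using disj \<open>finite P\<close> UC by (intro card_UN_disjoint') auto
  then have "card P = w * h" using C(2) by simp
  ultimately show ?thesis using that[of "C ` {1..w}"] UC by blast
qed

lemma rectangular_semiantichain:
  assumes rect: "rectangular P r w h" and "finite Q"
  obtains S where "semiantichain P r Q s S" "card S = w * max_antichain_union h Q s"
proof -
  obtain L where L: "\<And>i. i < h \<Longrightarrow> antichain P r (L i)" "disjoint_family_on L {..<h}"
    "\<And>i. i < h \<Longrightarrow> card (L i) = w"
    using rectangular_antichain_levels[OF rect] by blast
  obtain F where F: "\<And>i. i < h \<Longrightarrow> antichain Q s (F i)" "disjoint_family F"
    and card_F: "card (\<Union>i<h. F i) = max_antichain_union h Q s"
    using max_antichain_union_attained[OF \<open>finite Q\<close>, where k = h and r = s] by blast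
  have disj: "disjoint_family_on F {..<h}" using F(2) by (rule disjoint_family_on_mono[rotated]) simp
  have finL: "finite (L i)" if "i < h" for i
    using L(1)[OF that] rect finite_subset by (auto simp: antichain_def rectangular_def)
  have finF: "finite (F i)" if "i < h" for i
    using F(1)[OF that] \<open>finite Q\<close> finite_subset by (auto simp: antichain_def)
  have "semiantichain P r Q s (\<Union>i<h. L i \<times> F i)"
    using L(1,2) F(1) disj by (intro semiantichain_UN_Times) auto
  moreover have "card (\<Union>i<h. L i \<times> F i) = w * max_antichain_union h Q s"
    using card_UN_Times[of "{..<h}" L F w] finL finF L(3) disj card_F by simp
  ultimately show ?thesis using that by blast
qed

lemma rectangular_unichain_covering:
  assumes rect: "rectangular P r w h" and finQ: "finite Q" and poQ: "partial_order_on Q s"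
  obtains \<F> where "unichain_covering P r Q s \<F>" "card \<F> \<le> w * max_antichain_union h Q s"
proof -
  have finP: "finite P" and poP: "partial_order_on P r" using rect by (auto simp: rectangular_def)
  obtain \<C> where C: "finite \<C>" "\<C> \<subseteq> Chains r" "P = \<Union>\<C>" and size_C: "card \<C> \<le> w" "card P = w * h"
    using rectangular_chain_cover[OF rect] by blast
  obtain S \<D> where D: "finite \<D>" "\<D> \<subseteq> Chains s" "Q = S \<union> \<Union>\<D>"
    and size_D: "card S + h * card \<D> \<le> max_antichain_union h Q s"
    by (rule greene_kleitman_cover[OF finQ poQ])
  obtain \<F> where F: "unichain_covering P r Q s \<F>" "card \<F> \<le> card \<C> * card S + card P * card \<D>"
    by (rule unichain_covering_of_chain_covers[OF partial_order_onD(1)[OF poP]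
          partial_order_onD(1)[OF poQ] finP finQ C D])
  note F(2)
  also have "card \<C> * card S + card P * card \<D> \<le> w * card S + w * h * card \<D>"
    using size_C by (simp add: mult_le_mono1)
  also have "\<dots> = w * (card S + h * card \<D>)" by (simp add: algebra_simps)
  also have "\<dots> \<le> w * max_antichain_union h Q s" using size_D by (rule mult_le_mono2)
  finally show ?thesis using that F(1) by blast
qed

theorem theorem10:
  fixes P :: "'a set" and leP :: "'a rel" and Q :: "'b set" and leQ :: "'b rel" and w h :: nat
  assumes "rectangular P leP w h"
    and "finite Q" and "partial_order_on Q leQ"
  shows "max_semiantichain_size P leP Q leQ = min_unichain_covering_size P leP Q leQ \<and>
         min_unichain_covering_size P leP Q leQ = w * max_antichain_union h Q leQ"
proof -
  have P: "finite P" "partial_order_on P leP" using assms(1) by (auto simp: rectangular_def)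
  obtain S where S: "semiantichain P leP Q leQ S" "card S = w * max_antichain_union h Q leQ"
    using rectangular_semiantichain[OF assms(1,2)] by blast
  obtain \<F> where F: "unichain_covering P leP Q leQ \<F>" "card \<F> \<le> w * max_antichain_union h Q leQ"
    using rectangular_unichain_covering[OF assms] by blast
  have "card \<F> \<le> card S" using S(2) F(2) by simp
  then show ?thesis
    using semiantichain_unichain_covering_extremal[OF P assms(2,3) S(1) F(1)] S(2) by simp
qed

end
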